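(* Let $d\in\left(0,\frac{\ln(2+\sqrt3)}{2}\right)$, let $\beta\in\left[0,\,2\operatorname{sech}^4(d)-4\operatorname{sech}^2(d)\tanh^2(d)\right)$, and let $u_{\rm b}(y)=-\operatorname{sech}^2(y)$ for $y\in[-d,d]$. If $(u(x-ct,y),v(x-ct,y))$, with profile $(u,v)\in C^2(D_L)$ and wave speed $c\in\mathbb R$, is a traveling-wave solution of the $\beta$-plane equation in $D_L=\mathbb T_L\times[-d,d]$ with $v=0$ on $y=\pm d$, and $$\|\Delta u-u_{\rm b}''\|_{C^0(D_L)}<2\operatorname{sech}^4(d)-4\operatorname{sech}^2(d)\tanh^2(d)-\beta,$$ then $(u(x-ct,y),v(x-ct,y))$ is a shear flow.
   Context: Let $L>0$, $\mathbb T_L=\mathbb R/L\mathbb Z$, $D_L=\mathbb T_L\times[-d,d]$. For a constant $\beta\ge0$, the $\beta$-plane equation on $D_L$ is $$u_t+uu_x+vu_y-\beta yv=-P_x,\quad v_t+uv_x+vv_y+\beta yu=-P_y,\quad u_x+v_y=0,$$ with boundary condition $v=0$ on $y=\pm d$ ($P$ is the pressure). A traveling-wave solution of speed $c\in\mathbb R$ is a solution (for some pressure) of the form $(u(x-ct,y),v(x-ct,y))$; $(u,v)\in C^2(D_L)$ means that the profiles are $L$-periodic in the first variable and $C^2$ up to the boundary. It is a shear flow if $v\equiv0$ on $D_L$ (so that $u$ depends only on $y$). $\|\cdot\|_{C^0}$ is the sup norm and $\Delta=\partial_x^2+\partial_y^2$. *)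

theory Defs
  imports "HOL-Analysis.Analysis"
begin

text \<open>
  A function on \<open>D\<^sub>L = \<real>/L\<int> \<times> [-d, d]\<close> is represented by a curried function \<open>f x y\<close> on
  \<open>\<real> \<times> [-d, d]\<close> that is \<open>L\<close>-periodic in \<open>x\<close>; its values for \<open>y\<close> outside \<open>[-d, d]\<close> are irrelevant.
\<close>

definition channel :: "real \<Rightarrow> (real \<times> real) set" where
  "channel d = UNIV \<times> {-d..d}"

definition periodic_x :: "real \<Rightarrow> real \<Rightarrow> (real \<Rightarrow> real \<Rightarrow> real) \<Rightarrow> bool" where
  "periodic_x L d f \<longleftrightarrow> (\<forall>x. \<forall>y\<in>{-d..d}. f (x + L) y = f x y)"

definition Dx :: "(real \<Rightarrow> real \<Rightarrow> real) \<Rightarrow> real \<Rightarrow> real \<Rightarrow> real" where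
  "Dx f x y = deriv (\<lambda>s. f s y) x"

text \<open>The derivative in \<open>y\<close> is one-sided at \<open>y = d\<close> and \<open>y = -d\<close>.\<close>

definition Dy :: "real \<Rightarrow> (real \<Rightarrow> real \<Rightarrow> real) \<Rightarrow> real \<Rightarrow> real \<Rightarrow> real" where
  "Dy d f x y = vector_derivative (f x) (at y within {-d..d})"

text \<open>\<open>C\<^sup>1\<close> and \<open>C\<^sup>2\<close> regularity up to the boundary. The existence of the partial derivatives is
  required explicitly, since \<open>Dx\<close> and \<open>Dy\<close> are total functions.\<close>

definition C1_channel :: "real \<Rightarrow> (real \<Rightarrow> real \<Rightarrow> real) \<Rightarrow> bool" where
  "C1_channel d f \<longleftrightarrow>
     continuous_on (channel d) (\<lambda>(x, y). f x y) \<and>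
     (\<forall>x. \<forall>y\<in>{-d..d}. (\<lambda>s. f s y) differentiable (at x)
                    \<and> f x differentiable (at y within {-d..d})) \<and>
     continuous_on (channel d) (\<lambda>(x, y). Dx f x y) \<and>
     continuous_on (channel d) (\<lambda>(x, y). Dy d f x y)"

definition C1_D :: "real \<Rightarrow> real \<Rightarrow> (real \<Rightarrow> real \<Rightarrow> real) \<Rightarrow> bool" where
  "C1_D L d f \<longleftrightarrow> periodic_x L d f \<and> C1_channel d f"

definition C2_D :: "real \<Rightarrow> real \<Rightarrow> (real \<Rightarrow> real \<Rightarrow> real) \<Rightarrow> bool" where
  "C2_D L d f \<longleftrightarrow>
     periodic_x L d f \<and> C1_channel d f \<and> C1_channel d (Dx f) \<and> C1_channel d (Dy d f)"

definition laplacian :: "real \<Rightarrow> (real \<Rightarrow> real \<Rightarrow> real) \<Rightarrow> real \<Rightarrow> real \<Rightarrow> real" where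
  "laplacian d f x y = Dx (Dx f) x y + Dy d (Dy d f) x y"

text \<open>Meaningful for functions bounded on the channel, in particular for continuous periodic ones.\<close>

definition C0_norm :: "real \<Rightarrow> (real \<Rightarrow> real \<Rightarrow> real) \<Rightarrow> real" where
  "C0_norm d f = (SUP (x, y)\<in>channel d. \<bar>f x y\<bar>)"

text \<open>Time-dependent fields are written \<open>U t x y\<close>. The pressure \<open>P t\<close> is a function on \<open>D\<^sub>L\<close>, hence
  periodic in \<open>x\<close>; nothing is assumed about its dependence on \<open>t\<close>.\<close>

definition beta_plane_solution ::
  "real \<Rightarrow> real \<Rightarrow> real \<Rightarrow> (real \<Rightarrow> real \<Rightarrow> real \<Rightarrow> real) \<Rightarrow> (real \<Rightarrow> real \<Rightarrow> real \<Rightarrow> real) \<Rightarrow> bool" where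
  "beta_plane_solution L d \<beta> U V \<longleftrightarrow>
     (\<forall>t. C1_D L d (U t) \<and> C1_D L d (V t)) \<and>
     (\<forall>t x. \<forall>y\<in>{-d..d}. (\<lambda>s. U s x y) differentiable (at t)
                      \<and> (\<lambda>s. V s x y) differentiable (at t)) \<and>
     (\<exists>P. (\<forall>t. C1_D L d (P t)) \<and>
        (\<forall>t x. \<forall>y\<in>{-d..d}.
           deriv (\<lambda>s. U s x y) t + U t x y * Dx (U t) x y + V t x y * Dy d (U t) x y
             - \<beta> * y * V t x y = - Dx (P t) x y \<and>
           deriv (\<lambda>s. V s x y) t + U t x y * Dx (V t) x y + V t x y * Dy d (V t) x y
             + \<beta> * y * U t x y = - Dy d (P t) x y)) \<and>
     (\<forall>t x. \<forall>y\<in>{-d..d}. Dx (U t) x y + Dy d (V t) x y = 0) \<and>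
     (\<forall>t x. V t x (-d) = 0 \<and> V t x d = 0)"

definition wave :: "real \<Rightarrow> (real \<Rightarrow> real \<Rightarrow> real) \<Rightarrow> real \<Rightarrow> real \<Rightarrow> real \<Rightarrow> real" where
  "wave c f t x y = f (x - c * t) y"

definition shear_flow ::
  "real \<Rightarrow> (real \<Rightarrow> real \<Rightarrow> real \<Rightarrow> real) \<Rightarrow> (real \<Rightarrow> real \<Rightarrow> real \<Rightarrow> real) \<Rightarrow> bool" where
  "shear_flow d U V \<longleftrightarrow> (\<forall>t x. \<forall>y\<in>{-d..d}. V t x y = 0)"

definition sech :: "real \<Rightarrow> real" where
  "sech y = 1 / cosh y"

definition u_b :: "real \<Rightarrow> real" where
  "u_b y = - (sech y)\<^sup>2"

end

theory Submission
  imports Defs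
begin

text \<open>
  Write \<open>U = u - c\<close> and \<open>q = \<Delta>u - \<beta>\<close>. Since \<open>u\<^sub>b''\<close> is minimal on \<open>[-d, d]\<close> at the end points,
  the smallness assumption gives \<open>q \<ge> q\<^sub>0 > 0\<close>, and the curl of the momentum equations is \<open>U \<Delta>v = q v\<close>.
  Hence \<open>v = 0\<close> where \<open>U = 0\<close>, and where \<open>U > 0\<close> the function \<open>v\<^sup>2\<close> is strictly subharmonic unless
  \<open>v = 0\<close>, so the maximum principle yields \<open>v = 0\<close> on \<open>{U \<ge> 0}\<close>.

  On \<open>{U < 0}\<close> the equation has the opposite sign and the supersolution \<open>\<epsilon> - U\<close> is used instead.
  With \<open>k = 1 / (\<epsilon> - min U 0)\<close>, integrating
  \<open>div (v \<nabla>v + v\<^sup>2 k \<nabla>u) = |\<nabla>v + v k \<nabla>u|\<^sup>2 + v \<Delta>v + v\<^sup>2 k \<Delta>u\<close> over a period cell shows that the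
  integral of \<open>|\<nabla>v + v k \<nabla>u|\<^sup>2\<close> is \<open>O(\<epsilon>)\<close>, whence \<open>v u\<^sub>x = min U 0 v\<^sub>x\<close>. Together with incompressibility
  this makes the divergence of \<open>(y v min U 0, y v\<^sup>2)\<close> equal to \<open>v\<^sup>2\<close>, so the integral of \<open>v\<^sup>2\<close> vanishes.
\<close>

subsection \<open>Calculus on the channel\<close>

lemma C1_channelD:
  assumes "C1_channel d f"
  shows "y \<in> {-d..d} \<Longrightarrow> ((\<lambda>s. f s y) has_real_derivative Dx f x y) (at x)"
    and "y \<in> {-d..d} \<Longrightarrow> (f x has_real_derivative Dy d f x y) (at y within {-d..d})"
    and "continuous_on (channel d) (\<lambda>p. f (fst p) (snd p))"
    and "continuous_on (channel d) (\<lambda>p. Dx f (fst p) (snd p))"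
    and "continuous_on (channel d) (\<lambda>p. Dy d f (fst p) (snd p))"
  using assms unfolding C1_channel_def Dy_def
  by (simp_all add: case_prod_beta' Dx_def DERIV_deriv_iff_real_differentiable
      vector_derivative_works flip: has_real_derivative_iff_has_vector_derivative)

lemma periodic_x_Dx:
  assumes "periodic_x L d f"
  shows "periodic_x L d (Dx f)"
proof -
  have "deriv (\<lambda>s. f s y) (x + L) = deriv (\<lambda>s. f s y) x" if y: "y \<in> {-d..d}" for x y
  proof -
    have "((\<lambda>s. f s y) has_field_derivative D) (at (x + L)) \<longleftrightarrow>
        ((\<lambda>s. f s y) has_field_derivative D) (at x)" for D
      using assms y by (simp add: DERIV_shift periodic_x_def)
    then show ?thesis by (simp add: deriv_def)
  qed
  then show ?thesis by (simp add: periodic_x_def Dx_def)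
qed

lemma periodic_x_Dy:
  assumes "periodic_x L d f"
  shows "periodic_x L d (Dy d f)"
  using assms unfolding periodic_x_def Dy_def
  by (auto intro!: vector_derivative_cong_eq)

text \<open>The representative \<open>x'\<close> is fixed before \<open>f\<close> is quantified, so
  a single \<open>x'\<close> serves \<open>u\<close> and \<open>v\<close> simultaneously.\<close>

lemma periodic_x_reduce:
  assumes "L > 0"
  obtains x' where "x' \<in> {0..L}"
    and "\<And>d f y. periodic_x L d f \<Longrightarrow> y \<in> {-d..d} \<Longrightarrow> f x y = f x' y"
proof
  define n where "n = \<lfloor>x / L\<rfloor>"
  show "x - of_int n * L \<in> {0..L}"
    using assms floor_divide_lower[of L x] floor_divide_upper[of L x]
    by (auto simp: n_def algebra_simps)
  fix d f y assume per: "periodic_x L d f" and y: "y \<in> {-d..d}"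
  have nat: "f (z + of_nat k * L) y = f z y" for z k
  proof (induction k)
    case (Suc k)
    have "f (z + of_nat k * L + L) y = f (z + of_nat k * L) y"
      using per y by (simp add: periodic_x_def)
    with Suc show ?case by (simp add: algebra_simps)
  qed simp
  show "f x y = f (x - of_int n * L) y"
  proof (cases "0 \<le> n")
    case True
    then show ?thesis
      using nat[of "x - of_int n * L" "nat n"] by simp
  next
    case False
    then show ?thesis
      using nat[of x "nat (- n)"] by simp
  qed
qed

lemma compact_cell: "compact ({a..b} \<times> {-d..d::real})" for a b :: real
  by (intro compact_Times) auto

text \<open>The channel is not compact, but by periodicity all values are attained on one compact
  period cell.\<close>

lemma bounded_on_channel:
  assumes "L > 0" and "periodic_x L d f"
    and cont: "continuous_on (channel d) (\<lambda>p. f (fst p) (snd p))"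
  obtains B :: real where "B > 0" and "\<And>x y. y \<in> {-d..d} \<Longrightarrow> \<bar>f x y\<bar> \<le> B"
proof -
  have "compact ((\<lambda>p. f (fst p) (snd p)) ` ({0..L} \<times> {-d..d}))"
    by (intro compact_continuous_image compact_cell continuous_on_subset[OF cont])
      (auto simp: channel_def)
  then have "bounded ((\<lambda>p. f (fst p) (snd p)) ` ({0..L} \<times> {-d..d}))"
    by (rule compact_imp_bounded)
  then obtain B where "B > 0"
    and B: "\<And>p. p \<in> {0..L} \<times> {-d..d} \<Longrightarrow> \<bar>f (fst p) (snd p)\<bar> \<le> B"
    unfolding bounded_pos by (auto simp del: mem_Times_iff)
  show thesis
  proof
    fix x y :: real assume y: "y \<in> {-d..d}"
    obtain x' where "x' \<in> {0..L}" "f x y = f x' y"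
      using periodic_x_reduce[OF \<open>L > 0\<close>, of x] assms(2) y by metis
    then show "\<bar>f x y\<bar> \<le> B" using B[of "(x', y)"] y by simp
  qed fact
qed

text \<open>By Fubini, each term can be integrated first in its own variable: periodicity kills the
  flux in \<open>x\<close>, the boundary values kill the flux in \<open>y\<close>. Each component is
  differentiated only in its own direction, which suits fields built with the cutoff below.\<close>

lemma integral_divergence_eq_0:
  fixes X Y X' Y' :: "real \<Rightarrow> real \<Rightarrow> real"
  assumes "L > 0" and "d > 0"
    and X: "\<And>x y. y \<in> {-d..d} \<Longrightarrow> ((\<lambda>s. X s y) has_real_derivative X' x y) (at x)"
    and Y: "\<And>x y. y \<in> {-d..d} \<Longrightarrow> (Y x has_real_derivative Y' x y) (at y within {-d..d})"
    and cX: "continuous_on (channel d) (\<lambda>p. X' (fst p) (snd p))"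
    and cY: "continuous_on (channel d) (\<lambda>p. Y' (fst p) (snd p))"
    and per: "periodic_x L d X"
    and bdry: "\<And>x. Y x (-d) = 0" "\<And>x. Y x d = 0"
  shows "integral (cbox (a, -d) (a + L, d)) (\<lambda>p. X' (fst p) (snd p) + Y' (fst p) (snd p)) = 0"
proof -
  let ?C = "cbox (a, -d) (a + L, d)"
  have sub: "?C \<subseteq> channel d"
    by (auto simp: channel_def cbox_Pair_eq)
  note c = continuous_on_subset[OF cX sub] continuous_on_subset[OF cY sub]
  have "integral {a..a + L} (\<lambda>x. X' x y) = 0" if "y \<in> {-d..d}" for y
  proof -
    have "((\<lambda>x. X' x y) has_integral (X (a + L) y - X a y)) {a..a + L}"
      using \<open>L > 0\<close> X[OF that] by (intro fundamental_theorem_of_calculus)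
        (auto simp flip: has_real_derivative_iff_has_vector_derivative intro: DERIV_subset)
    then show ?thesis using per that by (auto simp: periodic_x_def)
  qed
  then have "integral {-d..d} (\<lambda>y. integral {a..a + L} (\<lambda>x. X' x y)) = integral {-d..d} (\<lambda>y. 0)"
    by (intro integral_cong)
  then have IX: "integral ?C (\<lambda>p. X' (fst p) (snd p)) = 0"
    using integral_prod_continuous[OF c(1)] integral_swap_continuous[of a "-d" "a + L" d X'] c(1)
    by (simp add: case_prod_beta')
  have "integral {-d..d} (Y' x) = 0" for x
  proof -
    have "(Y' x has_integral (Y x d - Y x (-d))) {-d..d}"
      using \<open>d > 0\<close> Y by (intro fundamental_theorem_of_calculus)
        (auto simp flip: has_real_derivative_iff_has_vector_derivative)
    then show ?thesis using bdry by auto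
  qed
  then have IY: "integral ?C (\<lambda>p. Y' (fst p) (snd p)) = 0"
    using integral_prod_continuous[OF c(2)] by simp
  show ?thesis
    using IX IY integral_add[OF integrable_continuous[OF c(1)] integrable_continuous[OF c(2)]] by simp
qed

lemma eq_0_if_integral_cbox_le_0:
  fixes f :: "'a::euclidean_space \<Rightarrow> real"
  assumes cont: "continuous_on (cbox a b) f" and "box a b \<noteq> {}"
    and nonneg: "\<And>x. x \<in> cbox a b \<Longrightarrow> 0 \<le> f x"
    and "integral (cbox a b) f \<le> 0" and "x \<in> cbox a b"
  shows "f x = 0"
proof -
  have "0 \<le> integral (cbox a b) f"
    using integrable_continuous[OF cont] nonneg by (rule integral_nonneg)
  then show ?thesis
    using integral_cbox_eq_0_iff[OF cont assms(2) nonneg] assms(4,5) by auto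
qed

text \<open>\<open>\<phi> (min g 0)\<close> alone has a corner where \<open>g = 0\<close>; the factor \<open>f\<close>, which vanishes there, removes it.\<close>

lemma has_real_derivative_mult_cutoff:
  fixes f g \<phi> \<phi>' :: "real \<Rightarrow> real"
  assumes f: "(f has_real_derivative f') (at x within S)"
    and g: "(g has_real_derivative g') (at x within S)"
    and zero: "0 \<le> g x \<Longrightarrow> f x = 0"
    and \<phi>: "\<And>s. s \<le> 0 \<Longrightarrow> (\<phi> has_real_derivative \<phi>' s) (at s)"
  shows "((\<lambda>z. f z * \<phi> (min (g z) 0)) has_real_derivative
    f' * \<phi> (min (g x) 0) + f x * (\<phi>' (min (g x) 0) * g')) (at x within S)"
proof (cases "g x < 0")
  case True
  have "(g \<longlongrightarrow> g x) (at x within S)"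
    using g DERIV_continuous continuous_within by blast
  then have ev: "\<forall>\<^sub>F z in at x within S. g z < 0"
    using True order_tendstoD(2) by blast
  have *: "((\<lambda>z. f z * \<phi> (g z)) has_real_derivative f' * \<phi> (g x) + f x * (\<phi>' (g x) * g'))
      (at x within S)"
    using DERIV_mult[OF f DERIV_chain2[OF \<phi> g]] True by (simp add: algebra_simps)
  show ?thesis
    using * True has_field_derivative_cong_eventually[of "\<lambda>z. f z * \<phi> (g z)"
        "\<lambda>z. f z * \<phi> (min (g z) 0)"] eventually_mono[OF ev]
    by (simp add: min_def)
next
  case False
  then have f0: "f x = 0" using zero by simp
  \<comment> \<open>Since \<open>f x = 0\<close>, the difference quotient of the product is that of
    \<open>f\<close> times the second factor, for which continuity is enough.\<close>
  have "isCont \<phi> (min (g x) 0)"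
    using \<phi> by (intro DERIV_isCont[where D = "\<phi>' (min (g x) 0)"]) auto
  moreover have "((\<lambda>z. min (g z) 0) \<longlongrightarrow> min (g x) 0) (at x within S)"
    using DERIV_continuous[OF g] by (intro tendsto_min tendsto_const) (simp add: continuous_within)
  ultimately have "((\<lambda>z. \<phi> (min (g z) 0)) \<longlongrightarrow> \<phi> (min (g x) 0)) (at x within S)"
    by (rule isCont_tendsto_compose)
  moreover have "((\<lambda>z. (f z - f x) / (z - x)) \<longlongrightarrow> f') (at x within S)"
    using f by (simp add: has_field_derivative_iff)
  ultimately have "((\<lambda>z. (f z - f x) / (z - x) * \<phi> (min (g z) 0)) \<longlongrightarrow> f' * \<phi> (min (g x) 0))
      (at x within S)"
    by (intro tendsto_mult)
  then show ?thesis
    by (simp add: has_field_derivative_iff f0)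
qed

text \<open>If \<open>f'' > 0\<close>, then \<open>f'\<close> vanishes at \<open>x\<close> and is
  positive just to its right, so the mean value theorem yields a larger value of \<open>f\<close>
  there.\<close>

lemma local_max_second_derivative_le_0:
  fixes f f' :: "real \<Rightarrow> real"
  assumes "e > 0"
    and f: "\<And>z. \<bar>z - x\<bar> < e \<Longrightarrow> (f has_real_derivative f' z) (at z)"
    and f': "(f' has_real_derivative f'') (at x)"
    and max: "\<And>z. \<bar>z - x\<bar> < e \<Longrightarrow> f z \<le> f x"
  shows "f'' \<le> 0"
proof (rule ccontr)
  assume "\<not> f'' \<le> 0"
  have "f' x = 0"
    using DERIV_local_max[OF f[of x] \<open>e > 0\<close>] max \<open>e > 0\<close> by (simp add: abs_minus_commute)
  then obtain h where "h > 0" and h: "\<And>k. 0 < k \<Longrightarrow> k < h \<Longrightarrow> 0 < f' (x + k)"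
    using DERIV_pos_inc_right[OF f'] \<open>\<not> f'' \<le> 0\<close> by auto
  define k where "k = min e h / 2"
  have k: "0 < k" "k < e" "k < h" using \<open>e > 0\<close> \<open>h > 0\<close> by (auto simp: k_def)
  have "\<exists>z. x < z \<and> z < x + k \<and> f (x + k) - f x = (x + k - x) * f' z"
    using k f by (intro MVT2) auto
  then obtain z where z: "x < z" "z < x + k" "f (x + k) - f x = k * f' z"
    by auto
  with h[of "z - x"] z k have "0 < k * f' z" by simp
  with z(3) max[of "x + k"] k show False by simp
qed

text \<open>Meant for the pressure, which is only C1: its mixed derivatives exist because the
  momentum equations express its gradient by \<open>u\<close> and \<open>v\<close>. Differentiating
  the integral of \<open>F\<close> over \<open>{x..b}\<close> in \<open>y\<close> gives the integral
  of \<open>F'\<close> as \<open>G b y - G x y\<close>; differentiating that in \<open>b\<close>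
  gives the claim. Working within \<open>S\<close> covers the walls as well.\<close>

lemma mixed_derivatives_eq:
  fixes P F G F' G' :: "real \<Rightarrow> real \<Rightarrow> real"
  assumes "convex S"
    and Px: "\<And>x y. y \<in> S \<Longrightarrow> ((\<lambda>s. P s y) has_real_derivative F x y) (at x)"
    and Py: "\<And>x y. y \<in> S \<Longrightarrow> (P x has_real_derivative G x y) (at y within S)"
    and Fy: "\<And>x y. y \<in> S \<Longrightarrow> (F x has_real_derivative F' x y) (at y within S)"
    and Gx: "\<And>x y. y \<in> S \<Longrightarrow> ((\<lambda>s. G s y) has_real_derivative G' x y) (at x)"
    and cF: "\<And>y. y \<in> S \<Longrightarrow> continuous_on UNIV (\<lambda>x. F x y)"
    and cF': "continuous_on (UNIV \<times> S) (\<lambda>p. F' (fst p) (snd p))"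
    and y: "y \<in> S" and nontriv: "at y within S \<noteq> bot"
  shows "F' x y = G' x y"
proof -
  have F'_int: "integral {x..b} (\<lambda>s. F' s y) = G b y - G x y" if "x \<le> b" for b
  proof -
    have 1: "((\<lambda>y. integral (cbox x b) (\<lambda>s. F s y)) has_real_derivative
        integral (cbox x b) (\<lambda>s. F' s y)) (at y within S)"
    proof (rule leibniz_rule_field_derivative)
      show "continuous_on (S \<times> cbox x b) (\<lambda>(y, s). F' s y)"
        unfolding case_prod_beta'
        by (rule continuous_on_compose2[OF cF', where f = "\<lambda>p. (snd p, fst p)", simplified])
          (auto intro!: continuous_intros)
    qed (use assms that in \<open>auto intro: integrable_continuous_real continuous_on_subset[OF cF]\<close>)
    have 2: "integral (cbox x b) (\<lambda>s. F s z) = P b z - P x z" if "z \<in> S" for z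
    proof -
      have "((\<lambda>s. F s z) has_integral (P b z - P x z)) {x..b}"
        using \<open>x \<le> b\<close> Px[OF that] by (intro fundamental_theorem_of_calculus)
          (auto simp flip: has_real_derivative_iff_has_vector_derivative intro: DERIV_subset)
      then show ?thesis by auto
    qed
    have "((\<lambda>y. P b y - P x y) has_real_derivative integral (cbox x b) (\<lambda>s. F' s y))
        (at y within S)"
      by (rule has_field_derivative_transform_within[OF 1 zero_less_one y]) (rule 2)
    from has_field_derivative_unique[OF this _ nontriv] show ?thesis
      using DERIV_diff[OF Py[OF y] Py[OF y]] by simp
  qed
  \<comment> \<open>\<open>F'_int\<close> is available for \<open>b\<close> to the right of
    \<open>x\<close> only, so a right derivative at \<open>x\<close> is taken; the length 1 is
    arbitrary.\<close>
  have "continuous_on {x..x + 1} (\<lambda>s. F' s y)"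
    by (rule continuous_on_compose2[OF cF', where f = "\<lambda>s. (s, y)", simplified])
      (use y in \<open>auto intro!: continuous_intros\<close>)
  from integral_has_real_derivative[OF this, of x]
  have "((\<lambda>b. integral {x..b} (\<lambda>s. F' s y)) has_real_derivative F' x y) (at x within {x..x + 1})"
    by simp
  then have 1: "((\<lambda>b. G b y - G x y) has_real_derivative F' x y) (at x within {x..x + 1})"
    by (rule has_field_derivative_transform_within[OF _ zero_less_one]) (simp_all add: F'_int)
  have "((\<lambda>b. G b y - G x y) has_real_derivative G' x y) (at x)"
    using DERIV_diff[OF Gx[OF y] DERIV_const] by simp
  then have "((\<lambda>b. G b y - G x y) has_real_derivative G' x y) (at x within {x..x + 1})"
    by (rule DERIV_subset) simp
  from has_field_derivative_unique[OF 1 this] show ?thesis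
    by (simp add: at_within_Icc_at_right trivial_limit_at_right_real)
qed

lemma at_within_Icc_neq_bot:
  fixes y :: real
  assumes "y \<in> {-d..d}" and "d > 0"
  shows "at y within {-d..d} \<noteq> bot"
  using assms by (simp add: trivial_limit_within islimpt_Icc)

subsection \<open>The vorticity equation\<close>

text \<open>At time 0 the time derivative of a wave is \<open>- c\<close> times its
  \<open>x\<close>-derivative, so \<open>F\<close> and \<open>G\<close> below are the two components
  of the gradient of \<open>P 0\<close>. Equality of its mixed derivatives is the curl of the
  momentum equations.\<close>

lemma beta_plane_wave_vorticity:
  assumes "d > 0" and u: "C2_D L d u" and v: "C2_D L d v"
    and sol: "beta_plane_solution L d \<beta> (wave c u) (wave c v)"
    and y: "y \<in> {-d..d}"
  shows "(u x y - c) * laplacian d v x y = v x y * (laplacian d u x y - \<beta>)"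
proof -
  let ?S = "{-d..d}"
  have C: "C1_channel d u" "C1_channel d (Dx u)" "C1_channel d (Dy d u)"
    "C1_channel d v" "C1_channel d (Dx v)" "C1_channel d (Dy d v)"
    using u v by (auto simp: C2_D_def)
  note dx = C[THEN C1_channelD(1)] and dy = C[THEN C1_channelD(2)]
    and cont = C[THEN C1_channelD(3)] C[THEN C1_channelD(4)] C[THEN C1_channelD(5)]
  have wave0: "wave c f 0 = f" for f
    by (simp add: wave_def fun_eq_iff)
  have dt: "deriv (\<lambda>s. wave c f s x y) 0 = - c * Dx f x y" if "C1_channel d f" "y \<in> ?S" for f x y
  proof (rule DERIV_imp_deriv)
    have "((\<lambda>s. x - c * s) has_real_derivative - c) (at 0)"
      by (auto intro!: derivative_eq_intros)
    from DERIV_chain2[OF _ this, of "\<lambda>s. f s y" "Dx f x y"] C1_channelD(1)[OF that]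
    show "((\<lambda>s. wave c f s x y) has_real_derivative - c * Dx f x y) (at 0)"
      by (simp add: wave_def mult.commute)
  qed
  obtain P where P: "\<And>t. C1_D L d (P t)"
    and mx: "\<And>t x y. y \<in> ?S \<Longrightarrow> deriv (\<lambda>s. wave c u s x y) t
      + wave c u t x y * Dx (wave c u t) x y + wave c v t x y * Dy d (wave c u t) x y
      - \<beta> * y * wave c v t x y = - Dx (P t) x y"
    and my: "\<And>t x y. y \<in> ?S \<Longrightarrow> deriv (\<lambda>s. wave c v s x y) t
      + wave c u t x y * Dx (wave c v t) x y + wave c v t x y * Dy d (wave c v t) x y
      + \<beta> * y * wave c u t x y = - Dy d (P t) x y"
    using sol unfolding beta_plane_solution_def by (elim conjE exE) (rule that, auto)
  have div: "Dx u x y = - Dy d v x y" if "y \<in> ?S" for x y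
  proof -
    have "Dx (wave c u 0) x y + Dy d (wave c v 0) x y = 0"
      using sol that unfolding beta_plane_solution_def by blast
    then show ?thesis by (simp add: wave0)
  qed
  define F where "F x y = - ((u x y - c) * Dx u x y + v x y * Dy d u x y - \<beta> * y * v x y)" for x y
  define G where "G x y = - ((u x y - c) * Dx v x y + v x y * Dy d v x y + \<beta> * y * u x y)" for x y
  have "C1_channel d (P 0)" using P by (simp add: C1_D_def)
  moreover have "Dx (P 0) x y = F x y" "Dy d (P 0) x y = G x y" if "y \<in> ?S" for x y
    using mx[OF that, of x 0] my[OF that, of x 0] that C(1,4)
    by (simp_all add: dt wave0 F_def G_def algebra_simps)
  ultimately have
    Px: "((\<lambda>s. P 0 s y) has_real_derivative F x y) (at x)" and
    Py: "(P 0 x has_real_derivative G x y) (at y within ?S)" if "y \<in> ?S" for x y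
    using C1_channelD(1,2)[of d "P 0"] that by metis+
  define F' where "F' x y = - (Dy d u x y * Dx u x y + (u x y - c) * Dy d (Dx u) x y
    + Dy d v x y * Dy d u x y + v x y * Dy d (Dy d u) x y - \<beta> * v x y - \<beta> * y * Dy d v x y)" for x y
  define G' where "G' x y = - (Dx u x y * Dx v x y + (u x y - c) * Dx (Dx v) x y
    + Dx v x y * Dy d v x y + v x y * Dx (Dy d v) x y + \<beta> * y * Dx u x y)" for x y
  have "F' x y = G' x y"
  proof (rule mixed_derivatives_eq[where S = ?S and P = "P 0" and F = F and G = G and F' = F' and G' = G'])
    show "(F x has_real_derivative F' x y) (at y within ?S)" if "y \<in> ?S" for x y
      unfolding F_def[abs_def] F'_def
      by (rule derivative_eq_intros dy refl that)+ (simp add: algebra_simps)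
    show "((\<lambda>s. G s y) has_real_derivative G' x y) (at x)" if "y \<in> ?S" for x y
      unfolding G_def G'_def
      by (rule derivative_eq_intros dx refl that)+ (simp add: algebra_simps)
    show "continuous_on (UNIV \<times> ?S) (\<lambda>p. F' (fst p) (snd p))"
      unfolding F'_def by (intro continuous_intros cont[unfolded channel_def])
    have "continuous_on (UNIV \<times> ?S) (\<lambda>p. F (fst p) (snd p))"
      unfolding F_def by (intro continuous_intros cont[unfolded channel_def])
    then show "continuous_on UNIV (\<lambda>x. F x y)" if "y \<in> ?S" for y
      using continuous_on_compose2[where f = "\<lambda>x. (x, y)" and s = UNIV] that
      by (fastforce intro!: continuous_intros)
  qed (use Px Py y at_within_Icc_neq_bot[OF y \<open>d > 0\<close>] in auto)
  \<comment> \<open>Differentiating the incompressibility condition turns the two mixed derivatives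
    that remain in the curl into pure ones, which combine to Laplacians.\<close>
  moreover have "Dx (Dy d v) x y = - Dx (Dx u) x y"
  proof (rule DERIV_unique[OF dx(6)[OF y]])
    show "((\<lambda>s. Dy d v s y) has_real_derivative - Dx (Dx u) x y) (at x)"
      using DERIV_minus[OF dx(2)[OF y]] y by (simp add: div)
  qed
  moreover have "Dy d (Dx u) x y = - Dy d (Dy d v) x y"
  proof (rule has_field_derivative_unique[OF dy(2)[OF y] _ at_within_Icc_neq_bot[OF y \<open>d > 0\<close>]])
    show "(Dx u x has_real_derivative - Dy d (Dy d v) x y) (at y within ?S)"
      by (rule has_field_derivative_transform_within[OF DERIV_minus[OF dy(6)[OF y]] zero_less_one y])
        (simp add: div)
  qed
  ultimately show ?thesis
    using div[OF y] by (simp add: F'_def G'_def laplacian_def algebra_simps)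
qed

subsection \<open>Rigidity of steady flows without inflection points\<close>

text \<open>Time and pressure are eliminated here. For a shear flow, \<open>no_inflection\<close>
  rules out the sign change of \<open>u'' - \<beta>\<close> that the Rayleigh-Kuo criterion requires
  for instability; the uniform constant \<open>q\<^sub>0\<close> later controls \<open>v\<close> by
  \<open>u - c\<close>.\<close>

locale steady_flow =
  fixes L d \<beta> c q\<^sub>0 :: real and u v :: "real \<Rightarrow> real \<Rightarrow> real"
  assumes L: "L > 0" and d: "d > 0" and \<beta>: "\<beta> \<ge> 0" and q\<^sub>0: "q\<^sub>0 > 0"
    and u: "C2_D L d u" and v: "C2_D L d v"
    and boundary: "\<And>x. v x (-d) = 0" "\<And>x. v x d = 0"
    and divergence: "\<And>x y. y \<in> {-d..d} \<Longrightarrow> Dx u x y + Dy d v x y = 0"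
    and vorticity: "\<And>x y. y \<in> {-d..d} \<Longrightarrow>
      (u x y - c) * laplacian d v x y = v x y * (laplacian d u x y - \<beta>)"
    and no_inflection: "\<And>x y. y \<in> {-d..d} \<Longrightarrow> q\<^sub>0 \<le> laplacian d u x y - \<beta>"
begin

lemma C1: "C1_channel d u" "C1_channel d (Dx u)" "C1_channel d (Dy d u)"
    "C1_channel d v" "C1_channel d (Dx v)" "C1_channel d (Dy d v)"
  using u v by (auto simp: C2_D_def)

lemmas dx = C1[THEN C1_channelD(1)] and dy = C1[THEN C1_channelD(2)]
  and cont = C1[THEN C1_channelD(3)] C1[THEN C1_channelD(4)] C1[THEN C1_channelD(5)]

lemma per: "periodic_x L d u" "periodic_x L d v"
  using u v by (auto simp: C2_D_def)

lemmas periodic = per per[THEN periodic_x_Dx] per[THEN periodic_x_Dx, THEN periodic_x_Dx]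
  per[THEN periodic_x_Dy] per[THEN periodic_x_Dy, THEN periodic_x_Dy]

section \<open>Maximum principle on the set where \<open>u\<close> is at least
  \<open>c\<close>\<close>

text \<open>Suppose the maximum of \<open>v^2\<close> over this set is positive. The maximum point
  is not on a wall, where \<open>v = 0\<close>, nor on \<open>u = c\<close>, where the vorticity
  equation forces \<open>v = 0\<close>. It is thus interior, and the second derivative test in each
  variable gives \<open>v * laplacian v <= 0\<close>, against the sign in the vorticity
  equation.\<close>

lemma v_eq_0_if_u_ge_c:
  assumes y: "y \<in> {-d..d}" and "c \<le> u x y"
  shows "v x y = 0"
proof (rule ccontr)
  assume nz: "v x y \<noteq> 0"
  let ?cell = "{0..L} \<times> {-d..d}"
  let ?K = "?cell \<inter> (\<lambda>p. u (fst p) (snd p)) -` {c..}"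
  have sub: "?cell \<subseteq> channel d" by (auto simp: channel_def)
  have "closed ?K"
    by (intro continuous_closed_preimage continuous_on_subset[OF cont(1) sub]
        compact_imp_closed[OF compact_cell]) auto
  then have "compact (?cell \<inter> ?K)"
    by (intro compact_Int_closed compact_cell)
  then have "compact ?K" by (simp add: Int_absorb1)
  obtain x' where x': "x' \<in> {0..L}" "u x y = u x' y" "v x y = v x' y"
    using periodic_x_reduce[OF L, of x] per y by metis
  have "continuous_on ?K (\<lambda>p. (v (fst p) (snd p))\<^sup>2)"
    using sub by (intro continuous_intros continuous_on_subset[OF cont(4)]) auto
  moreover have "(x', y) \<in> ?K" using x' y assms(2) by auto
  ultimately obtain p where p: "p \<in> ?K"
    and pmax: "\<And>z. z \<in> ?K \<Longrightarrow> (v (fst z) (snd z))\<^sup>2 \<le> (v (fst p) (snd p))\<^sup>2"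
    using continuous_attains_sup[OF \<open>compact ?K\<close>] by blast
  obtain a b where ab: "p = (a, b)" by fastforce
  have b: "b \<in> {-d..d}" using p ab by auto
  \<comment> \<open>The maximum is extended from the cell to the whole channel, so that
    \<open>a\<close> may be varied to both sides even when it is 0 or \<open>L\<close>.\<close>
  have max: "(v s t)\<^sup>2 \<le> (v a b)\<^sup>2" if t: "t \<in> {-d..d}" and "c \<le> u s t" for s t
  proof -
    obtain s' where "s' \<in> {0..L}" "u s t = u s' t" "v s t = v s' t"
      using periodic_x_reduce[OF L, of s] per t by metis
    then show ?thesis using pmax[of "(s', t)"] that ab by auto
  qed
  have "v a b \<noteq> 0"
    using max[OF y assms(2)] nz by auto
  then have b': "-d < b" "b < d"
    using boundary[of a] b by (auto simp: less_le)
  have q: "0 < laplacian d u a b - \<beta>"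
    using no_inflection[OF b, of a] q\<^sub>0 by simp
  have "u a b \<noteq> c"
    using vorticity[OF b, of a] \<open>v a b \<noteq> 0\<close> q by auto
  then have ub: "u a b > c" using p ab by auto
  have dyb: "(f a has_real_derivative Dy d f a t) (at t)"
    if "C1_channel d f" "-d < t" "t < d" for f t
    using C1_channelD(2)[OF that(1), of t a] that by (simp add: at_within_Icc_at)
  have "((\<lambda>s. u s b) \<longlongrightarrow> u a b) (nhds a)"
    using DERIV_isCont[OF dx(1)[OF b]] unfolding isCont_def by (rule tendsto_at_iff_tendsto_nhds[THEN iffD1])
  then have "\<forall>\<^sub>F s in nhds a. c < u s b"
    using ub by (rule order_tendstoD)
  then obtain e\<^sub>1 where e\<^sub>1: "e\<^sub>1 > 0" "\<And>s. \<bar>s - a\<bar> < e\<^sub>1 \<Longrightarrow> c < u s b"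
    by (auto simp: eventually_nhds_metric dist_real_def)
  have "2 * ((Dx v a b)\<^sup>2 + v a b * Dx (Dx v) a b) \<le> 0"
  proof (rule local_max_second_derivative_le_0[OF e\<^sub>1(1)])
    show "((\<lambda>s. (v s b)\<^sup>2) has_real_derivative 2 * v s b * Dx v s b) (at s)" for s
      by (rule derivative_eq_intros dx b refl)+ simp
    show "((\<lambda>s. 2 * v s b * Dx v s b) has_real_derivative
        2 * ((Dx v a b)\<^sup>2 + v a b * Dx (Dx v) a b)) (at a)"
      by (rule derivative_eq_intros dx b refl)+ (simp add: algebra_simps power2_eq_square)
    show "(v s b)\<^sup>2 \<le> (v a b)\<^sup>2" if "\<bar>s - a\<bar> < e\<^sub>1" for s
      using max[OF b] e\<^sub>1(2)[OF that] by simp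
  qed
  moreover have "((u a) \<longlongrightarrow> u a b) (nhds b)"
    using DERIV_isCont[OF dyb[OF C1(1) b']] unfolding isCont_def by (rule tendsto_at_iff_tendsto_nhds[THEN iffD1])
  then have "\<forall>\<^sub>F t in nhds b. c < u a t"
    using ub by (rule order_tendstoD)
  then obtain e\<^sub>2 where e\<^sub>2: "e\<^sub>2 > 0" "\<And>t. \<bar>t - b\<bar> < e\<^sub>2 \<Longrightarrow> c < u a t"
    by (auto simp: eventually_nhds_metric dist_real_def)
  \<comment> \<open>The distance to the walls enters so that \<open>Dy\<close> is a two-sided
    derivative throughout the neighbourhood.\<close>
  define e where "e = min e\<^sub>2 (min (b + d) (d - b))"
  have e: "e > 0" "\<And>t. \<bar>t - b\<bar> < e \<Longrightarrow> -d < t \<and> t < d \<and> c < u a t"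
    using e\<^sub>2 b' by (auto simp: e_def)
  have "2 * ((Dy d v a b)\<^sup>2 + v a b * Dy d (Dy d v) a b) \<le> 0"
  proof (rule local_max_second_derivative_le_0[OF e(1)])
    show "((\<lambda>t. (v a t)\<^sup>2) has_real_derivative 2 * v a t * Dy d v a t) (at t)" if "\<bar>t - b\<bar> < e" for t
      using e(2)[OF that] by (auto intro!: derivative_eq_intros dyb C1)
    show "((\<lambda>t. 2 * v a t * Dy d v a t) has_real_derivative
        2 * ((Dy d v a b)\<^sup>2 + v a b * Dy d (Dy d v) a b)) (at b)"
      using b' by (auto intro!: derivative_eq_intros dyb C1 simp: algebra_simps power2_eq_square)
    show "(v a t)\<^sup>2 \<le> (v a b)\<^sup>2" if "\<bar>t - b\<bar> < e" for t
      using max[of t a] e(2)[OF that] by simp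
  qed
  ultimately have "v a b * laplacian d v a b \<le> 0"
    unfolding laplacian_def
    using zero_le_power2[of "Dx v a b"] zero_le_power2[of "Dy d v a b"]
    by (simp only: distrib_left)
  moreover have "(u a b - c) * (v a b * laplacian d v a b) = (v a b)\<^sup>2 * (laplacian d u a b - \<beta>)"
    using arg_cong[OF vorticity[OF b, of a], of "(*) (v a b)"]
    by (simp only: power2_eq_square mult_ac)
  moreover have "0 < (v a b)\<^sup>2 * (laplacian d u a b - \<beta>)"
    using q \<open>v a b \<noteq> 0\<close> by simp
  ultimately show False
    using ub by (smt (verit) mult_nonneg_nonpos)
qed

section \<open>Energy estimate on the set where \<open>u\<close> is below \<open>c\<close>\<close>

lemmas v_mult_cutoff_dx = has_real_derivative_mult_cutoff[OF dx(4) DERIV_diff[OF dx(1) DERIV_const]]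
  and v_mult_cutoff_dy = has_real_derivative_mult_cutoff[OF dy(4) DERIV_diff[OF dy(1) DERIV_const]]

text \<open>Truncating \<open>u - c\<close> at 0 keeps \<open>\<epsilon> - cutoff\<close> at least
  \<open>\<epsilon>\<close> on the whole channel. The corner at \<open>u = c\<close> does no harm in
  products with \<open>v\<close>, which vanishes there.\<close>

definition cutoff :: "real \<Rightarrow> real \<Rightarrow> real" where
  "cutoff x y = min (u x y - c) 0"

lemma cont_cutoff: "continuous_on (channel d) (\<lambda>p. cutoff (fst p) (snd p))"
  unfolding cutoff_def by (intro continuous_intros cont)

text \<open>The bound \<open>v = O(|U|)\<close> makes the error term \<open>v \<Delta>v \<epsilon> k\<close> of the energy identity uniformly \<open>O(\<epsilon>)\<close>.\<close>

lemma abs_v_le: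
  assumes "y \<in> {-d..d}" and "\<bar>laplacian d v x y\<bar> \<le> C"
  shows "\<bar>v x y\<bar> * q\<^sub>0 \<le> - cutoff x y * C"
proof (cases "u x y < c")
  case True
  have "\<bar>v x y\<bar> * q\<^sub>0 \<le> \<bar>v x y\<bar> * \<bar>laplacian d u x y - \<beta>\<bar>"
    using no_inflection[OF assms(1), of x] by (intro mult_left_mono) auto
  also have "\<dots> = \<bar>u x y - c\<bar> * \<bar>laplacian d v x y\<bar>"
    using vorticity[OF assms(1), of x] by (simp flip: abs_mult)
  also have "\<dots> \<le> \<bar>u x y - c\<bar> * C"
    using assms(2) by (intro mult_left_mono) auto
  finally show ?thesis using True by (simp add: cutoff_def)
next
  case False
  then show ?thesis using v_eq_0_if_u_ge_c[OF assms(1), of x] by (simp add: cutoff_def)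
qed

text \<open>Write \<open>U = u - c < 0\<close>. Then \<open>k * \<epsilon> = 1 + k * U\<close>, and
  the vorticity equation makes the right-hand side equal to
  \<open>v * laplacian v * k * \<epsilon>\<close> plus the nonnegative term
  \<open>\<beta> * v^2 * k\<close>. The first term is small because \<open>abs_v_le\<close> gives
  \<open>|v * laplacian v| <= |U| * C^2 / q\<^sub>0\<close>, while
  \<open>|U| * k <= 1\<close>.\<close>

lemma energy_density_ge:
  assumes y: "y \<in> {-d..d}" and \<epsilon>: "\<epsilon> > 0" and C: "\<bar>laplacian d v x y\<bar> \<le> C"
    and k: "k = 1 / (\<epsilon> - cutoff x y)"
  shows "- (C\<^sup>2 / q\<^sub>0 * \<epsilon>) \<le> v x y * laplacian d v x y + (v x y)\<^sup>2 * k * laplacian d u x y"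
proof (cases "u x y < c")
  case False
  then show ?thesis
    using v_eq_0_if_u_ge_c[OF y, of x] \<epsilon> q\<^sub>0 by simp
next
  case True
  define U where "U = u x y - c"
  have U: "U < 0" "cutoff x y = U" using True by (auto simp: U_def cutoff_def)
  have k0: "0 < k" "k * (\<epsilon> - U) = 1" using k U \<epsilon> by auto
  have "0 \<le> C" using C by linarith
  have "\<bar>v x y * laplacian d v x y\<bar> * q\<^sub>0 = (\<bar>v x y\<bar> * q\<^sub>0) * \<bar>laplacian d v x y\<bar>"
    by (simp add: abs_mult)
  also have "\<dots> \<le> (- U * C) * C"
    by (rule mult_mono[OF _ C]) (use abs_v_le[OF y C] U \<open>0 \<le> C\<close> in \<open>auto simp: mult_le_0_iff\<close>)
  finally have "\<bar>v x y * laplacian d v x y\<bar> \<le> - U * (C\<^sup>2 / q\<^sub>0)"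
    using q\<^sub>0 by (simp add: field_simps power2_eq_square)
  then have "- (v x y * laplacian d v x y) * (k * \<epsilon>) \<le> - U * (C\<^sup>2 / q\<^sub>0) * (k * \<epsilon>)"
    using k0 \<epsilon> by (intro mult_right_mono) auto
  also have "\<dots> = (- U * k) * (C\<^sup>2 / q\<^sub>0 * \<epsilon>)" by simp
  also have "\<dots> \<le> 1 * (C\<^sup>2 / q\<^sub>0 * \<epsilon>)"
    using k0 mult_pos_pos[OF k0(1) \<epsilon>] \<epsilon> q\<^sub>0 by (intro mult_right_mono) (auto simp: algebra_simps)
  finally have 1: "- (C\<^sup>2 / q\<^sub>0 * \<epsilon>) \<le> v x y * laplacian d v x y * (k * \<epsilon>)" by simp
  have "k * \<epsilon> = 1 + k * U" using k0(2) by (simp add: algebra_simps)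
  then have "v x y * laplacian d v x y * (k * \<epsilon>) =
      v x y * laplacian d v x y + v x y * k * (U * laplacian d v x y)"
    by (simp add: algebra_simps)
  also have "\<dots> = v x y * laplacian d v x y + (v x y)\<^sup>2 * k * (laplacian d u x y - \<beta>)"
    using vorticity[OF y, of x] by (simp add: U_def power2_eq_square)
  also have "\<dots> \<le> v x y * laplacian d v x y + (v x y)\<^sup>2 * k * laplacian d u x y"
    using \<beta> k0 by (simp add: algebra_simps)
  finally show ?thesis using 1 by linarith
qed

text \<open>\<open>Z\<close> does not depend on \<open>\<epsilon>\<close>, and neither does the
  integral, so \<open>\<epsilon>\<close> can tend to 0 afterwards. The integrand is the square of
  \<open>(\<epsilon> - cutoff) * w - \<epsilon> * Dx v\<close>, where \<open>w\<close> is the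
  \<open>x\<close>-component of the vector whose square appears in the energy identity.\<close>

lemma integral_square_le:
  obtains Z where "\<And>\<epsilon>. 0 < \<epsilon> \<Longrightarrow> \<epsilon> \<le> 1 \<Longrightarrow>
    integral (cbox (a, -d) (a + L, d))
      (\<lambda>p. (v (fst p) (snd p) * Dx u (fst p) (snd p) - cutoff (fst p) (snd p) * Dx v (fst p) (snd p))\<^sup>2)
      \<le> Z * \<epsilon>"
proof -
  let ?C = "cbox (a, -d) (a + L, d)"
  have sub: "?C \<subseteq> channel d"
    by (auto simp: channel_def cbox_Pair_eq)
  obtain B where B: "\<And>x y. y \<in> {-d..d} \<Longrightarrow> \<bar>Dx v x y\<bar> \<le> B"
    using bounded_on_channel[OF L _ cont(5)] periodic by metis
  have "periodic_x L d (laplacian d v)"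
    using periodic by (auto simp: periodic_x_def laplacian_def)
  moreover have "continuous_on (channel d) (\<lambda>p. laplacian d v (fst p) (snd p))"
    unfolding laplacian_def by (intro continuous_intros cont)
  ultimately obtain C where C: "\<And>x y. y \<in> {-d..d} \<Longrightarrow> \<bar>laplacian d v x y\<bar> \<le> C"
    using bounded_on_channel[OF L] by metis
  have "periodic_x L d cutoff"
    using per by (simp add: periodic_x_def cutoff_def)
  then obtain M where M: "M > 0" "\<And>x y. y \<in> {-d..d} \<Longrightarrow> \<bar>cutoff x y\<bar> \<le> M"
    using bounded_on_channel[OF L _ cont_cutoff] by metis
  define r where "r x y = v x y * Dx u x y - cutoff x y * Dx v x y" for x y
  \<comment> \<open>The factors 2 come from \<open>(s - t)^2 <= 2 * s^2 + 2 * t^2\<close>;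
    \<open>M + 1\<close> bounds \<open>\<epsilon> - cutoff\<close> for
    \<open>\<epsilon> <= 1\<close>, and \<open>B\<close> bounds \<open>Dx v\<close>.\<close>
  define K where "K = 2 * (M + 1)\<^sup>2 * (C\<^sup>2 / q\<^sub>0) + 2 * B\<^sup>2"
  have "integral ?C (\<lambda>p. (r (fst p) (snd p))\<^sup>2) \<le> (measure lborel ?C * K) * \<epsilon>" if \<epsilon>: "0 < \<epsilon>" "\<epsilon> \<le> 1" for \<epsilon>
  proof -
    define k where "k x y = 1 / (\<epsilon> - cutoff x y)" for x y
    have pos: "0 < \<epsilon> - cutoff x y" for x y using \<epsilon> by (simp add: cutoff_def)
    have cont_k: "continuous_on (channel d) (\<lambda>p. k (fst p) (snd p))"
      unfolding k_def using pos
      by (intro continuous_intros cont_cutoff) (simp add: less_le)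
    have \<phi>: "((\<lambda>s. 1 / (\<epsilon> - s)) has_real_derivative 1 / (\<epsilon> - s)\<^sup>2) (at s)" if "s \<le> 0" for s
      using that \<epsilon> by (auto intro!: derivative_eq_intros simp: power2_eq_square)
    \<comment> \<open>\<open>gx\<close> and \<open>gy\<close> are the partial derivatives of
      \<open>v * k\<close>; this product is differentiable although \<open>k\<close> may fail to be
      where \<open>u = c\<close>.\<close>
    define gx where "gx x y = Dx v x y * k x y + v x y * (k x y)\<^sup>2 * Dx u x y" for x y
    define gy where "gy x y = Dy d v x y * k x y + v x y * (k x y)\<^sup>2 * Dy d u x y" for x y
    have gx: "((\<lambda>s. v s y * k s y) has_real_derivative gx x y) (at x)" if "y \<in> {-d..d}" for x y
      using v_mult_cutoff_dx[OF that that _ \<phi>] v_eq_0_if_u_ge_c[OF that]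
      by (simp add: k_def cutoff_def gx_def power_one_over algebra_simps)
    have gy: "((\<lambda>t. v x t * k x t) has_real_derivative gy x y) (at y within {-d..d})"
      if "y \<in> {-d..d}" for x y
      using v_mult_cutoff_dy[OF that that _ \<phi>] v_eq_0_if_u_ge_c[OF that]
      by (simp add: k_def cutoff_def gy_def power_one_over algebra_simps)
    \<comment> \<open>The field is \<open>v * (grad v + (v * k) * grad u)\<close>, grouped so that
      \<open>k\<close> is differentiated only together with a factor \<open>v\<close>.\<close>
    define X' where "X' x y = Dx v x y * (Dx v x y + v x y * k x y * Dx u x y)
      + v x y * (Dx (Dx v) x y + (gx x y * Dx u x y + v x y * k x y * Dx (Dx u) x y))" for x y
    define Y' where "Y' x y = Dy d v x y * (Dy d v x y + v x y * k x y * Dy d u x y)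
      + v x y * (Dy d (Dy d v) x y + (gy x y * Dy d u x y + v x y * k x y * Dy d (Dy d u) x y))" for x y
    have cX: "continuous_on (channel d) (\<lambda>p. X' (fst p) (snd p))"
      unfolding X'_def gx_def by (intro continuous_intros cont cont_k)
    have cY: "continuous_on (channel d) (\<lambda>p. Y' (fst p) (snd p))"
      unfolding Y'_def gy_def by (intro continuous_intros cont cont_k)
    have I: "integral ?C (\<lambda>p. X' (fst p) (snd p) + Y' (fst p) (snd p)) = 0"
    proof (rule integral_divergence_eq_0[OF L d _ _ cX cY])
      show "((\<lambda>s. v s y * (Dx v s y + v s y * k s y * Dx u s y)) has_real_derivative X' x y) (at x)"
        if "y \<in> {-d..d}" for x y
        unfolding X'_def
        by (rule derivative_eq_intros dx gx refl that)+ (simp add: algebra_simps)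
      show "((\<lambda>t. v x t * (Dy d v x t + v x t * k x t * Dy d u x t)) has_real_derivative Y' x y)
          (at y within {-d..d})"
        if "y \<in> {-d..d}" for x y
        unfolding Y'_def
        by (rule derivative_eq_intros dy gy refl that)+ (simp add: algebra_simps)
      show "periodic_x L d (\<lambda>x y. v x y * (Dx v x y + v x y * k x y * Dx u x y))"
        using periodic by (simp add: periodic_x_def k_def cutoff_def)
    qed (simp_all add: boundary)
    have pw: "(r x y)\<^sup>2 \<le> 2 * (M + 1)\<^sup>2 * (X' x y + Y' x y) + K * \<epsilon>" if y: "y \<in> {-d..d}" for x y
    proof -
      define w where "w = Dx v x y + v x y * k x y * Dx u x y"
      have "X' x y + Y' x y = w\<^sup>2 + (Dy d v x y + v x y * k x y * Dy d u x y)\<^sup>2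
          + (v x y * laplacian d v x y + (v x y)\<^sup>2 * k x y * laplacian d u x y)"
        by (simp add: X'_def Y'_def gx_def gy_def w_def laplacian_def power2_eq_square algebra_simps)
      moreover have "- (C\<^sup>2 / q\<^sub>0 * \<epsilon>) \<le>
          v x y * laplacian d v x y + (v x y)\<^sup>2 * k x y * laplacian d u x y"
        using energy_density_ge[OF y \<epsilon>(1) C[OF y]] k_def by blast
      ultimately have 1: "w\<^sup>2 \<le> X' x y + Y' x y + C\<^sup>2 / q\<^sub>0 * \<epsilon>"
        using zero_le_power2[of "Dy d v x y + v x y * k x y * Dy d u x y"] by linarith
      have kpos: "(\<epsilon> - cutoff x y) * k x y = 1" using pos[of x y] by (simp add: k_def)
      have "r x y = (\<epsilon> - cutoff x y) * w - \<epsilon> * Dx v x y"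
      proof -
        have "(\<epsilon> - cutoff x y) * w = (\<epsilon> - cutoff x y) * Dx v x y + ((\<epsilon> - cutoff x y) * k x y) * (v x y * Dx u x y)"
          by (simp add: w_def algebra_simps)
        then show ?thesis unfolding kpos by (simp add: r_def algebra_simps)
      qed
      moreover have "(s - t)\<^sup>2 \<le> 2 * s\<^sup>2 + 2 * t\<^sup>2" for s t :: real
        using zero_le_power2[of "s + t"] by (simp add: power2_eq_square algebra_simps)
      ultimately have "(r x y)\<^sup>2 \<le> 2 * ((\<epsilon> - cutoff x y) * w)\<^sup>2 + 2 * (\<epsilon> * Dx v x y)\<^sup>2"
        by simp
      moreover have "((\<epsilon> - cutoff x y) * w)\<^sup>2 \<le> (M + 1)\<^sup>2 * (X' x y + Y' x y + C\<^sup>2 / q\<^sub>0 * \<epsilon>)"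
      proof -
        have "(\<epsilon> - cutoff x y)\<^sup>2 \<le> (M + 1)\<^sup>2"
          using M(2)[OF y, of x] \<epsilon> pos[of x y] by (intro power_mono) auto
        then show ?thesis
          unfolding power_mult_distrib using 1 by (intro mult_mono) auto
      qed
      moreover have "(\<epsilon> * Dx v x y)\<^sup>2 \<le> \<epsilon> * B\<^sup>2"
      proof -
        have "\<epsilon>\<^sup>2 \<le> \<epsilon>" using \<epsilon> by (simp add: power2_eq_square mult_le_cancel_right1)
        moreover have "(Dx v x y)\<^sup>2 \<le> B\<^sup>2" using B[OF y] by (rule abs_le_square_iff[THEN iffD1, OF order_trans]) auto
        ultimately show ?thesis
          unfolding power_mult_distrib using \<epsilon> by (intro mult_mono) auto
      qed
      ultimately have "(r x y)\<^sup>2 \<le> 2 * ((M + 1)\<^sup>2 * (X' x y + Y' x y + C\<^sup>2 / q\<^sub>0 * \<epsilon>)) + 2 * (\<epsilon> * B\<^sup>2)"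
        by linarith
      also have "\<dots> = 2 * (M + 1)\<^sup>2 * (X' x y + Y' x y) + K * \<epsilon>"
        by (simp add: K_def algebra_simps)
      finally show ?thesis .
    qed
    have c1: "continuous_on ?C (\<lambda>p. X' (fst p) (snd p) + Y' (fst p) (snd p))"
      by (intro continuous_on_subset[OF _ sub] continuous_intros cX cY)
    have "integral ?C (\<lambda>p. (r (fst p) (snd p))\<^sup>2) \<le>
        integral ?C (\<lambda>p. 2 * (M + 1)\<^sup>2 * (X' (fst p) (snd p) + Y' (fst p) (snd p)) + K * \<epsilon>)"
    proof (rule integral_le)
      show "(\<lambda>p. (r (fst p) (snd p))\<^sup>2) integrable_on ?C"
        unfolding r_def
        by (intro integrable_continuous continuous_on_subset[OF _ sub] continuous_intros cont cont_cutoff)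
      show "(\<lambda>p. 2 * (M + 1)\<^sup>2 * (X' (fst p) (snd p) + Y' (fst p) (snd p)) + K * \<epsilon>) integrable_on ?C"
        by (intro integrable_continuous continuous_intros c1)
    qed (use sub pw in \<open>auto simp: channel_def\<close>)
    also have "\<dots> = 2 * (M + 1)\<^sup>2 * integral ?C (\<lambda>p. X' (fst p) (snd p) + Y' (fst p) (snd p))
        + integral ?C (\<lambda>p. K * \<epsilon>)"
      by (subst integral_add) (auto intro!: integrable_continuous continuous_intros c1)
    finally show ?thesis
      unfolding I by (simp add: mult_ac)
  qed
  then show thesis
    unfolding r_def by (rule that)
qed

section \<open>Vanishing of \<open>v\<close>\<close>

text \<open>Where \<open>u < c\<close>, this says that \<open>v / (u - c)\<close> has zero
  \<open>x\<close>-derivative. It is the limit of \<open>integral_square_le\<close> as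
  \<open>\<epsilon>\<close> tends to 0 from the right.\<close>

lemma v_Dx_u_eq:
  assumes y: "y \<in> {-d..d}"
  shows "v x y * Dx u x y = cutoff x y * Dx v x y"
proof -
  let ?C = "cbox (x, -d) (x + L, d)"
  let ?f = "\<lambda>p. (v (fst p) (snd p) * Dx u (fst p) (snd p) - cutoff (fst p) (snd p) * Dx v (fst p) (snd p))\<^sup>2"
  obtain Z where Z: "\<And>\<epsilon>. 0 < \<epsilon> \<Longrightarrow> \<epsilon> \<le> 1 \<Longrightarrow> integral ?C ?f \<le> Z * \<epsilon>"
    using integral_square_le[of x] by blast
  have "integral ?C ?f \<le> 0"
  proof (rule tendsto_lowerbound)
    show "((\<lambda>\<epsilon>. Z * \<epsilon>) \<longlongrightarrow> 0) (at_right 0)"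
      by (auto intro!: tendsto_eq_intros)
    show "\<forall>\<^sub>F \<epsilon> in at_right 0. integral ?C ?f \<le> Z * \<epsilon>"
      unfolding eventually_at_right_field using Z by (intro exI[of _ 1]) auto
  qed simp
  moreover have "continuous_on ?C ?f"
    by (rule continuous_on_subset[of "channel d"])
      (auto simp: channel_def cbox_Pair_eq intro!: continuous_intros cont[unfolded channel_def]
        cont_cutoff[unfolded channel_def])
  moreover have "box (x, -d) (x + L, d) \<noteq> {}"
    using L d by (auto simp: box_ne_empty Basis_prod_def)
  ultimately have "?f (x, y) = 0"
    using L y by (intro eq_0_if_integral_cbox_le_0) (auto simp: cbox_Pair_eq)
  then show ?thesis by simp
qed

text \<open>By \<open>v_Dx_u_eq\<close> and incompressibility the field
  \<open>(v * cutoff, v^2)\<close> is divergence free. Multiplying it by the weight \<open>y\<close>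
  leaves exactly \<open>v^2\<close> as divergence, and the flux through the walls is 0 because
  \<open>v\<close> is.\<close>

lemma v_eq_0:
  assumes y: "y \<in> {-d..d}"
  shows "v x y = 0"
proof -
  let ?C = "cbox (x, -d) (x + L, d)"
  define X' where "X' x y = y * (Dx v x y * cutoff x y + v x y * Dx u x y)" for x y
  define Y' where "Y' x y = (v x y)\<^sup>2 + y * (2 * v x y * Dy d v x y)" for x y
  have "integral ?C (\<lambda>p. X' (fst p) (snd p) + Y' (fst p) (snd p)) = 0"
  proof (rule integral_divergence_eq_0[OF L d])
    show "((\<lambda>s. y * (v s y * cutoff s y)) has_real_derivative X' x y) (at x)" if "y \<in> {-d..d}" for x y
      \<comment> \<open>This is the cutoff rule with \<phi> the identity; \<open>Dx u\<close> may
        stand for the derivative of \<open>cutoff\<close> everywhere since it is multiplied by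
        \<open>v\<close>.\<close>
      using DERIV_cmult[OF v_mult_cutoff_dx[OF that that _ DERIV_ident], of x c y] v_eq_0_if_u_ge_c[OF that]
      by (simp add: X'_def cutoff_def)
    show "((\<lambda>t. t * (v x t)\<^sup>2) has_real_derivative Y' x y) (at y within {-d..d})"
      if "y \<in> {-d..d}" for x y
      unfolding Y'_def by (rule derivative_eq_intros dy refl that)+ simp
    show "continuous_on (channel d) (\<lambda>p. X' (fst p) (snd p))"
      "continuous_on (channel d) (\<lambda>p. Y' (fst p) (snd p))"
      unfolding X'_def Y'_def by (intro continuous_intros cont cont_cutoff)+
    show "periodic_x L d (\<lambda>x y. y * (v x y * cutoff x y))"
      using per by (simp add: periodic_x_def cutoff_def)
  qed (simp_all add: boundary)
  moreover have "X' x y + Y' x y = (v x y)\<^sup>2" if "y \<in> {-d..d}" for x y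
  proof -
    have "Dy d v x y = - Dx u x y" using divergence[OF that, of x] by simp
    then show ?thesis
      using v_Dx_u_eq[OF that, of x] by (simp add: X'_def Y'_def algebra_simps)
  qed
  then have "integral ?C (\<lambda>p. X' (fst p) (snd p) + Y' (fst p) (snd p)) =
      integral ?C (\<lambda>p. (v (fst p) (snd p))\<^sup>2)"
    by (intro integral_cong) (auto simp: cbox_Pair_eq)
  moreover have "continuous_on ?C (\<lambda>p. (v (fst p) (snd p))\<^sup>2)"
    by (rule continuous_on_subset[of "channel d"])
      (auto simp: channel_def cbox_Pair_eq intro!: continuous_intros cont[unfolded channel_def])
  moreover have "box (x, -d) (x + L, d) \<noteq> {}"
    using L d by (auto simp: box_ne_empty Basis_prod_def)
  ultimately have "(v (fst (x, y)) (snd (x, y)))\<^sup>2 = 0"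
    using L y by (intro eq_0_if_integral_cbox_le_0[of "(x, -d)" "(x + L, d)"]) (auto simp: cbox_Pair_eq)
  then show ?thesis by simp
qed

end

subsection \<open>The base flow\<close>

lemma deriv_deriv_u_b: "deriv (deriv u_b) y = 6 * sech y ^ 4 - 4 * (sech y)\<^sup>2"
proof -
  have c: "cosh y \<noteq> 0" for y :: real using cosh_real_pos[of y] by simp
  have "(u_b has_real_derivative 2 * sinh y / cosh y ^ 3) (at y)" for y
    unfolding u_b_def[abs_def] sech_def
    by (rule derivative_eq_intros refl c)+ (use c[of y] in \<open>simp add: field_simps eval_nat_numeral\<close>)
  then have "deriv u_b = (\<lambda>y. 2 * sinh y / cosh y ^ 3)"
    by (intro ext DERIV_imp_deriv)
  moreover have "((\<lambda>y. 2 * sinh y / cosh y ^ 3) has_real_derivative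
      (2 * cosh y * cosh y ^ 3 - 2 * sinh y * (3 * cosh y ^ 2 * sinh y)) / (cosh y ^ 3)\<^sup>2) (at y)"
    by (rule derivative_eq_intros refl)+ (use c[of y] in \<open>simp_all add: field_simps eval_nat_numeral\<close>)
  moreover have "(2 * cosh y * cosh y ^ 3 - 2 * sinh y * (3 * cosh y ^ 2 * sinh y)) / (cosh y ^ 3)\<^sup>2
      = 6 * sech y ^ 4 - 4 * (sech y)\<^sup>2"
  proof -
    have "2 * cosh y * cosh y ^ 3 - 2 * sinh y * (3 * cosh y ^ 2 * sinh y) =
        2 * cosh y ^ 4 - 6 * cosh y ^ 2 * (sinh y)\<^sup>2"
      by (simp add: eval_nat_numeral)
    also have "\<dots> = cosh y ^ 2 * (6 - 4 * cosh y ^ 2)"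
      unfolding sinh_square_eq by (simp add: eval_nat_numeral algebra_simps)
    finally show ?thesis
      using c[of y] by (simp add: sech_def field_simps eval_nat_numeral)
  qed
  ultimately show ?thesis by (simp add: DERIV_imp_deriv)
qed

text \<open>Together with \<open>deriv_deriv_u_b\<close> this identifies the threshold of the
  theorem as the second derivative of \<open>u_b\<close> at the wall.\<close>

lemma sech_tanh_eq: "2 * sech d ^ 4 - 4 * (sech d)\<^sup>2 * (tanh d)\<^sup>2 = 6 * sech d ^ 4 - 4 * (sech d)\<^sup>2"
proof -
  have c: "cosh d \<noteq> 0" using cosh_real_pos[of d] by simp
  have *: "(tanh d)\<^sup>2 = 1 - (sech d)\<^sup>2"
    using c by (simp add: tanh_def sech_def power_divide sinh_square_eq diff_divide_distrib)
  show ?thesis unfolding * by (simp add: eval_nat_numeral algebra_simps)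
qed

text \<open>With \<open>a = (sech y)^2\<close> and \<open>b = (sech d)^2\<close>, the difference of
  the two sides is \<open>(a - b) * (6 * (a + b) - 4)\<close>. Here \<open>a >= b\<close> as
  \<open>cosh\<close> increases with the absolute value, and \<open>pos\<close> amounts to
  \<open>b >= 2/3\<close>, so both factors are nonnegative.\<close>

lemma deriv_deriv_u_b_ge:
  assumes y: "y \<in> {-d..d}" and pos: "0 \<le> 6 * sech d ^ 4 - 4 * (sech d)\<^sup>2"
  shows "6 * sech d ^ 4 - 4 * (sech d)\<^sup>2 \<le> deriv (deriv u_b) y"
proof -
  have "cosh \<bar>y\<bar> \<le> cosh \<bar>d\<bar>"
    using y by (subst cosh_real_nonneg_le_iff) auto
  then have "sech d \<le> sech y"
    by (simp add: sech_def frac_le)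
  moreover have "0 < sech d" by (simp add: sech_def)
  ultimately have le: "(sech d)\<^sup>2 \<le> (sech y)\<^sup>2" by (intro power_mono) auto
  have "0 \<le> (sech d)\<^sup>2 * (6 * (sech d)\<^sup>2 - 4)"
    using pos by (simp add: eval_nat_numeral algebra_simps)
  then have "4 \<le> 6 * (sech d)\<^sup>2"
    using \<open>0 < sech d\<close> by (simp add: zero_le_mult_iff)
  then have "0 \<le> ((sech y)\<^sup>2 - (sech d)\<^sup>2) * (6 * ((sech y)\<^sup>2 + (sech d)\<^sup>2) - 4)"
    using le by (intro mult_nonneg_nonneg) auto
  then show ?thesis
    unfolding deriv_deriv_u_b by (simp add: eval_nat_numeral algebra_simps)
qed

text \<open>The supremum bounds the values only once the set is known to be bounded above;
  periodicity and continuity provide this.\<close>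

lemma abs_le_C0_norm:
  assumes "L > 0" and "periodic_x L d f" and "continuous_on (channel d) (\<lambda>p. f (fst p) (snd p))"
    and "y \<in> {-d..d}"
  shows "\<bar>f x y\<bar> \<le> C0_norm d f"
proof -
  obtain B where "\<And>x y. y \<in> {-d..d} \<Longrightarrow> \<bar>f x y\<bar> \<le> B"
    using bounded_on_channel[OF assms(1-3)] by metis
  then have "bdd_above ((\<lambda>(x, y). \<bar>f x y\<bar>) ` channel d)"
    by (intro bdd_aboveI2[of _ _ B]) (auto simp: channel_def)
  then show ?thesis
    unfolding C0_norm_def using cSUP_upper[of "(x, y)" "channel d" "\<lambda>(x, y). \<bar>f x y\<bar>"] assms(4)
    by (simp add: channel_def)
qed

theorem proposition6p3:
  fixes L d \<beta> c :: real and u v :: "real \<Rightarrow> real \<Rightarrow> real"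
  assumes "L > 0"
    and "0 < d" and "d < ln (2 + sqrt 3) / 2"
    and "0 \<le> \<beta>" and "\<beta> < 2 * sech d ^ 4 - 4 * (sech d)\<^sup>2 * (tanh d)\<^sup>2"
    and "C2_D L d u" and "C2_D L d v"
    and "beta_plane_solution L d \<beta> (wave c u) (wave c v)"
    and "C0_norm d (\<lambda>x y. laplacian d u x y - deriv (deriv u_b) y)
           < 2 * sech d ^ 4 - 4 * (sech d)\<^sup>2 * (tanh d)\<^sup>2 - \<beta>"
  shows "shear_flow d (wave c u) (wave c v)"
proof -
  define \<mu> where "\<mu> = 6 * sech d ^ 4 - 4 * (sech d)\<^sup>2"
  let ?N = "C0_norm d (\<lambda>x y. laplacian d u x y - deriv (deriv u_b) y)"
  note \<mu> = sech_tanh_eq[of d, folded \<mu>_def]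
  have wave0: "wave c f 0 = f" for f
    by (simp add: wave_def fun_eq_iff)
  have u: "periodic_x L d u" "C1_channel d u" "C1_channel d (Dx u)" "C1_channel d (Dy d u)"
    using assms(6) by (auto simp: C2_D_def)
  have "periodic_x L d (\<lambda>x y. laplacian d u x y - deriv (deriv u_b) y)"
    using u(1)[THEN periodic_x_Dx, THEN periodic_x_Dx] u(1)[THEN periodic_x_Dy, THEN periodic_x_Dy]
    by (auto simp: periodic_x_def laplacian_def)
  moreover have "continuous_on (channel d)
      (\<lambda>p. laplacian d u (fst p) (snd p) - deriv (deriv u_b) (snd p))"
    unfolding laplacian_def deriv_deriv_u_b sech_def
    by (intro continuous_intros u(3)[THEN C1_channelD(4)] u(4)[THEN C1_channelD(5)]) auto
  ultimately have N: "\<bar>laplacian d u x y - deriv (deriv u_b) y\<bar> \<le> ?N" if "y \<in> {-d..d}" for x y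
    using abs_le_C0_norm[OF \<open>L > 0\<close>, of d "\<lambda>x y. laplacian d u x y - deriv (deriv u_b) y"] that by blast
  \<comment> \<open>\<open>\<mu>\<close> is the minimum of the second derivative of
    \<open>u_b\<close>, and \<open>laplacian d u\<close> differs from that derivative by at most
    \<open>?N\<close>. The smallness assumption says exactly that the resulting bound
    \<open>\<mu> - \<beta> - ?N\<close> is positive.\<close>
  interpret steady_flow L d \<beta> c "\<mu> - \<beta> - ?N" u v
  proof
    show "\<mu> - \<beta> - ?N \<le> laplacian d u x y - \<beta>" if "y \<in> {-d..d}" for x y
      using N[OF that, of x] deriv_deriv_u_b_ge[OF that] assms(4,5) unfolding \<mu> \<mu>_def[symmetric]
      by linarith
    show "v x (-d) = 0" "v x d = 0" for x
      using assms(8) wave0[of v] unfolding beta_plane_solution_def by metis+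
    show "Dx u x y + Dy d v x y = 0" if "y \<in> {-d..d}" for x y
      using assms(8) wave0 that unfolding beta_plane_solution_def by metis
  qed (use assms beta_plane_wave_vorticity \<mu> in auto)
  show ?thesis
    by (simp add: shear_flow_def wave_def v_eq_0)
qed

end
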